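(* Let $d\geq 2$ and let $\gamma:\mathbb{R}^d\to\mathbb{R}$ be a gauge. If Birkhoff orthogonality is left additive, i.e., for all $x,y,z\in\mathbb{R}^d$, $x\perp_B z$ and $y\perp_B z$ together imply $(x+y)\perp_B z$, then $\gamma$ is a norm.
   Context: A gauge is a function $\gamma:\mathbb{R}^d\to\mathbb{R}$ such that $\gamma(x)\geq 0$ for all $x$, $\gamma(x)=0$ implies $x=0$, $\gamma(\lambda x)=\lambda\gamma(x)$ for all $\lambda>0$, and $\gamma(x+y)\leq\gamma(x)+\gamma(y)$ (it need not be symmetric). Birkhoff orthogonality $x\perp_B y$ means $\gamma(x)\leq\gamma(x+\lambda y)$ for all $\lambda\in\mathbb{R}$. *)

theory Defs
  imports "HOL-Analysis.Analysis"
begin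

(* gamma 0 = 0 is not listed: it follows from positive homogeneity.  The library constant
   "gauge" (Henstock-Kurzweil integration) is unrelated. *)
definition gauge_fun :: "('a::real_vector \<Rightarrow> real) \<Rightarrow> bool" where
  "gauge_fun \<gamma> \<longleftrightarrow>
     (\<forall>x. \<gamma> x \<ge> 0) \<and>
     (\<forall>x. \<gamma> x = 0 \<longrightarrow> x = 0) \<and>
     (\<forall>c x. c > 0 \<longrightarrow> \<gamma> (c *\<^sub>R x) = c * \<gamma> x) \<and>
     (\<forall>x y. \<gamma> (x + y) \<le> \<gamma> x + \<gamma> y)"

(* A predicate on functions; the library's norm is a fixed type class operation. *)
definition norm_fun :: "('a::real_vector \<Rightarrow> real) \<Rightarrow> bool" where
  "norm_fun \<gamma> \<longleftrightarrow>
     (\<forall>x. \<gamma> x \<ge> 0) \<and>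
     (\<forall>x. \<gamma> x = 0 \<longleftrightarrow> x = 0) \<and>
     (\<forall>c x. \<gamma> (c *\<^sub>R x) = \<bar>c\<bar> * \<gamma> x) \<and>
     (\<forall>x y. \<gamma> (x + y) \<le> \<gamma> x + \<gamma> y)"

definition birkhoff_orth :: "('a::real_vector \<Rightarrow> real) \<Rightarrow> 'a \<Rightarrow> 'a \<Rightarrow> bool" where
  "birkhoff_orth \<gamma> x y \<longleftrightarrow> (\<forall>c::real. \<gamma> x \<le> \<gamma> (x + c *\<^sub>R y))"

definition birkhoff_left_additive :: "('a::real_vector \<Rightarrow> real) \<Rightarrow> bool" where
  "birkhoff_left_additive \<gamma> \<longleftrightarrow>
     (\<forall>x y z. birkhoff_orth \<gamma> x z \<and> birkhoff_orth \<gamma> y z \<longrightarrow> birkhoff_orth \<gamma> (x + y) z)"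

end

(* Minimizing gamma on the line -x + R z gives x' with x' orthogonal to z; if x is orthogonal to z,
   left additivity makes x + x', a multiple of z, orthogonal to z, which forces x + x' = 0.  Hence
   orthogonality to z passes from x to -x: the unit ball has the same supporting directions at x
   as at -x.  Along a line p + t v avoiding 0 this says that f t = gamma (p + t v) and
   g t = gamma (- (p + t v)) have matching subgradients relative to their values, so ln f and
   ln g have the same derivative and g / f is constant.  Joining p to -p through a third point q
   outside their span, gamma (-p) / gamma p equals its own inverse. *)
theory Submission
  imports Defs
begin

section \<open>Gauges along lines and existence of Birkhoff orthogonal points\<close>

context
  fixes \<gamma> :: "'a::real_vector \<Rightarrow> real"
  assumes gauge: "gauge_fun \<gamma>"
begin

lemma gauge_nonneg: "\<gamma> x \<ge> 0"
  and gauge_eq_0D: "\<gamma> x = 0 \<Longrightarrow> x = 0"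
  and gauge_scale_pos: "c > 0 \<Longrightarrow> \<gamma> (c *\<^sub>R x) = c * \<gamma> x"
  and gauge_triangle: "\<gamma> (x + y) \<le> \<gamma> x + \<gamma> y"
  using gauge by (auto simp: gauge_fun_def)

lemma gauge_zero: "\<gamma> 0 = 0"
  using gauge_scale_pos[of 2 0] by simp

lemma gauge_scale: "c \<ge> 0 \<Longrightarrow> \<gamma> (c *\<^sub>R x) = c * \<gamma> x"
  by (cases "c = 0") (auto simp: gauge_zero gauge_scale_pos)

lemma gauge_pos: "x \<noteq> 0 \<Longrightarrow> \<gamma> x > 0"
  using gauge_nonneg[of x] gauge_eq_0D[of x] by linarith

lemma gauge_convex_on_line: "convex_on UNIV (\<lambda>t. \<gamma> (x + t *\<^sub>R v))"
proof (rule convex_onI)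
  fix u a b :: real assume u: "0 < u" "u < 1"
  have "x + ((1 - u) *\<^sub>R a + u *\<^sub>R b) *\<^sub>R v
      = (1 - u) *\<^sub>R (x + a *\<^sub>R v) + u *\<^sub>R (x + b *\<^sub>R v)"
    by (simp add: algebra_simps)
  also have "\<gamma> \<dots> \<le> \<gamma> ((1 - u) *\<^sub>R (x + a *\<^sub>R v)) + \<gamma> (u *\<^sub>R (x + b *\<^sub>R v))"
    by (rule gauge_triangle)
  also have "\<dots> = (1 - u) * \<gamma> (x + a *\<^sub>R v) + u * \<gamma> (x + b *\<^sub>R v)"
    using u by (simp add: gauge_scale_pos)
  finally show "\<gamma> (x + ((1 - u) *\<^sub>R a + u *\<^sub>R b) *\<^sub>R v)
      \<le> (1 - u) * \<gamma> (x + a *\<^sub>R v) + u * \<gamma> (x + b *\<^sub>R v)" .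
qed simp

lemma gauge_continuous_on_line: "continuous_on A (\<lambda>t. \<gamma> (x + t *\<^sub>R v))"
  using convex_on_continuous[OF open_UNIV gauge_convex_on_line] continuous_on_subset by blast

text \<open>The triangle inequality is applied to \<open>t *\<^sub>R z\<close> as the sum of
  \<open>x + t *\<^sub>R z\<close> and \<open>- x\<close>. The minimum covers both signs of
  \<open>t\<close>, as \<open>\<gamma>\<close> may differ at \<open>z\<close> and
  \<open>- z\<close>.\<close>

lemma gauge_line_coercive: "\<bar>t\<bar> * min (\<gamma> z) (\<gamma> (- z)) \<le> \<gamma> (x + t *\<^sub>R z) + \<gamma> (- x)"
proof -
  have "\<bar>t\<bar> * min (\<gamma> z) (\<gamma> (- z)) \<le> \<gamma> (t *\<^sub>R z)"
  proof (cases "t \<ge> 0")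
    case True
    then show ?thesis by (simp add: gauge_scale mult_left_mono)
  next
    case False
    then have "\<gamma> (t *\<^sub>R z) = \<bar>t\<bar> * \<gamma> (- z)"
      using gauge_scale[of "- t" "- z"] by simp
    then show ?thesis by (simp add: mult_left_mono)
  qed
  also have "\<dots> \<le> \<gamma> (x + t *\<^sub>R z) + \<gamma> (- x)"
    using gauge_triangle[of "x + t *\<^sub>R z" "- x"] by simp
  finally show ?thesis .
qed

lemma birkhoff_orth_exists_on_line:
  assumes "z \<noteq> 0"
  obtains c where "birkhoff_orth \<gamma> (x + c *\<^sub>R z) z"
proof -
  define m where "m = min (\<gamma> z) (\<gamma> (- z))"
  have m: "m > 0" using gauge_pos[of z] gauge_pos[of "- z"] assms by (simp add: m_def)
  \<comment> \<open>Beyond \<open>M\<close> coercivity already gives at least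
    \<open>\<gamma> x\<close>, the value at \<open>t = 0\<close>, so a minimum over the compact
    interval is global.\<close>
  define M where "M = (\<gamma> x + \<gamma> (- x)) / m"
  have M: "M \<ge> 0" using m gauge_nonneg by (simp add: M_def)
  obtain c where c: "\<And>t. t \<in> {-M..M} \<Longrightarrow> \<gamma> (x + c *\<^sub>R z) \<le> \<gamma> (x + t *\<^sub>R z)"
    using continuous_attains_inf[of "{-M..M}" "\<lambda>t. \<gamma> (x + t *\<^sub>R z)"]
      gauge_continuous_on_line M by fastforce
  have min: "\<gamma> (x + c *\<^sub>R z) \<le> \<gamma> (x + t *\<^sub>R z)" for t
  proof (cases "\<bar>t\<bar> \<le> M")
    case True
    then show ?thesis using c by (auto simp: abs_le_iff)
  next
    case False
    then have "\<gamma> x + \<gamma> (- x) \<le> \<bar>t\<bar> * m"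
      using m by (simp add: M_def pos_divide_le_eq not_le mult.commute less_imp_le pos_divide_less_eq)
    also have "\<dots> \<le> \<gamma> (x + t *\<^sub>R z) + \<gamma> (- x)"
      unfolding m_def by (rule gauge_line_coercive)
    finally show ?thesis using c[of 0] M by simp
  qed
  have "birkhoff_orth \<gamma> (x + c *\<^sub>R z) z"
    unfolding birkhoff_orth_def
  proof
    fix k
    show "\<gamma> (x + c *\<^sub>R z) \<le> \<gamma> (x + c *\<^sub>R z + k *\<^sub>R z)"
      using min[of "c + k"] by (simp add: algebra_simps)
  qed
  then show thesis by (rule that)
qed

section \<open>Transfer of orthogonality and subgradients from a point to its opposite\<close>

lemma birkhoff_orth_uminus_left:
  assumes add: "birkhoff_left_additive \<gamma>" and x: "birkhoff_orth \<gamma> x z"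
  shows "birkhoff_orth \<gamma> (- x) z"
proof (cases "z = 0")
  case True
  then show ?thesis by (simp add: birkhoff_orth_def)
next
  case False
  obtain c where c: "birkhoff_orth \<gamma> (- x + c *\<^sub>R z) z"
    using birkhoff_orth_exists_on_line[OF False] .
  have "birkhoff_orth \<gamma> (x + (- x + c *\<^sub>R z)) z"
    using add x c unfolding birkhoff_left_additive_def by blast
  \<comment> \<open>The sum is \<open>c *\<^sub>R z\<close>; moving it by \<open>- c\<close> along
    \<open>z\<close> reaches the origin, where \<open>\<gamma>\<close> vanishes.\<close>
  then have "\<gamma> (c *\<^sub>R z) \<le> \<gamma> (c *\<^sub>R z + (- c) *\<^sub>R z)"
    by (simp add: birkhoff_orth_def del: scaleR_minus_left)
  then have "\<gamma> (c *\<^sub>R z) = 0"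
    using gauge_nonneg[of "c *\<^sub>R z"] by (simp add: gauge_zero)
  then show ?thesis using c gauge_eq_0D by force
qed

text \<open>A supporting functional at \<open>x\<close> with slope \<open>s\<close> along
  \<open>v\<close> has slope \<open>\<gamma> x\<close> along \<open>x\<close> itself, by
  homogeneity. The combination of \<open>v\<close> and \<open>x\<close> chosen here has slope
  zero.\<close>

lemma birkhoff_orth_of_subgradient:
  assumes x: "x \<noteq> 0" and s: "\<And>h. \<gamma> x + s * h \<le> \<gamma> (x + h *\<^sub>R v)"
  shows "birkhoff_orth \<gamma> x (v - (s / \<gamma> x) *\<^sub>R x)"
proof -
  define z where "z = v - (s / \<gamma> x) *\<^sub>R x"
  have px: "\<gamma> x > 0" using x by (rule gauge_pos)
  \<comment> \<open>For these \<open>k\<close> the point \<open>x + k *\<^sub>R z\<close> is a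
    positive multiple of a point on the line through \<open>x\<close> in direction \<open>v\<close>,
    where the subgradient inequality applies.\<close>
  have near: "\<gamma> x \<le> \<gamma> (x + k *\<^sub>R z)" if k: "k * s / \<gamma> x < 1" for k
  proof -
    define c where "c = 1 - k * s / \<gamma> x"
    have c: "c > 0" using k by (simp add: c_def)
    have "x + k *\<^sub>R z = c *\<^sub>R x + k *\<^sub>R v"
      by (simp add: z_def c_def algebra_simps)
    also have "\<dots> = c *\<^sub>R (x + (k / c) *\<^sub>R v)"
      using c by (simp add: scaleR_add_right)
    finally have "\<gamma> (x + k *\<^sub>R z) = c * \<gamma> (x + (k / c) *\<^sub>R v)"
      using c by (simp add: gauge_scale_pos)
    also have "\<dots> \<ge> c * (\<gamma> x + s * (k / c))"
      using c by (intro mult_left_mono s) simp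
    also have "c * (\<gamma> x + s * (k / c)) = c * \<gamma> x + s * k"
      using c by (simp add: distrib_left)
    also have "\<dots> = \<gamma> x" using px by (simp add: c_def field_simps)
    finally show ?thesis .
  qed
  have "\<gamma> x \<le> \<gamma> (x + k *\<^sub>R z)" for k
  proof -
    define w where "w = k * s / \<gamma> x"
    \<comment> \<open>The factor \<open>e\<close> in (0,1] shrinks an arbitrary \<open>k\<close>
      into the range of \<open>near\<close>; convexity between \<open>x\<close> and
      \<open>x + k *\<^sub>R z\<close> then carries the bound back to \<open>k\<close>.\<close>
    define e where "e = 1 / (1 + \<bar>w\<bar>)"
    have "1 + \<bar>w\<bar> \<ge> 1" by simp
    then have e: "0 < e" "e \<le> 1" by (auto simp: e_def divide_simps)
    have "e * k * s / \<gamma> x = w / (1 + \<bar>w\<bar>)"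
      by (simp add: e_def w_def)
    also have "\<dots> < 1" by (simp add: pos_divide_less_eq)
    finally have "\<gamma> x \<le> \<gamma> (x + (e * k) *\<^sub>R z)" by (rule near)
    also have "x + (e * k) *\<^sub>R z = (1 - e) *\<^sub>R x + e *\<^sub>R (x + k *\<^sub>R z)"
      by (simp add: algebra_simps)
    also have "\<gamma> \<dots> \<le> (1 - e) * \<gamma> x + e * \<gamma> (x + k *\<^sub>R z)"
      using gauge_triangle[of "(1 - e) *\<^sub>R x" "e *\<^sub>R (x + k *\<^sub>R z)"] e
      by (simp add: gauge_scale)
    finally have "e * \<gamma> x \<le> e * \<gamma> (x + k *\<^sub>R z)" by (simp add: algebra_simps)
    then show ?thesis using e by simp
  qed
  then show ?thesis by (simp add: birkhoff_orth_def z_def)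
qed

text \<open>Both points are orthogonal to the same direction, so slopes divided by values agree:
  slope \<open>s\<close> at \<open>x\<close> along \<open>v\<close> becomes
  \<open>s * \<gamma> (- x) / \<gamma> x\<close> at \<open>- x\<close> along
  \<open>- v\<close>.\<close>

lemma subgradient_opposite:
  assumes add: "birkhoff_left_additive \<gamma>"
    and x: "x \<noteq> 0" and s: "\<And>h. \<gamma> x + s * h \<le> \<gamma> (x + h *\<^sub>R v)"
  shows "\<gamma> (- x) * (1 + s * h / \<gamma> x) \<le> \<gamma> (- (x + h *\<^sub>R v))"
proof (cases "1 + s * h / \<gamma> x > 0")
  case True
  define c where "c = 1 + s * h / \<gamma> x"
  define z where "z = v - (s / \<gamma> x) *\<^sub>R x"
  have c: "c > 0" using True by (simp add: c_def)
  have "birkhoff_orth \<gamma> (- x) z"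
    unfolding z_def by (intro birkhoff_orth_uminus_left birkhoff_orth_of_subgradient add x s)
  \<comment> \<open>The target \<open>- (x + h *\<^sub>R v)\<close> is \<open>c\<close> times a
    point on the line through \<open>- x\<close> in direction \<open>z\<close>, and
    \<open>- x\<close> minimizes \<open>\<gamma>\<close> on that line.\<close>
  then have "c * \<gamma> (- x) \<le> c * \<gamma> (- x + (- (h / c)) *\<^sub>R z)"
    using c unfolding birkhoff_orth_def by (intro mult_left_mono) (blast, simp)
  also have "\<dots> = \<gamma> (c *\<^sub>R (- x + (- (h / c)) *\<^sub>R z))"
    using c by (simp add: gauge_scale_pos)
  also have "c *\<^sub>R (- x + (- (h / c)) *\<^sub>R z) = - (c *\<^sub>R x) - h *\<^sub>R z"
    using c by (simp add: scaleR_diff_right)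
  also have "\<dots> = - (x + h *\<^sub>R v)"
    by (simp add: c_def z_def algebra_simps)
  finally show ?thesis by (simp add: c_def mult.commute)
next
  case False
  then have "\<gamma> (- x) * (1 + s * h / \<gamma> x) \<le> 0"
    using gauge_nonneg by (simp add: mult_nonneg_nonpos)
  then show ?thesis using gauge_nonneg order_trans by blast
qed

end

section \<open>Monotonicity of the ratio of opposite values along a line\<close>

text \<open>The error terms are summed over the partition of the unit interval into \<open>n\<close> equal
  parts: the increments of \<open>S\<close> telescope and the factor \<open>1 / n\<close> remains.\<close>

lemma le_of_product_increment_bound:
  fixes R S :: "real \<Rightarrow> real"
  assumes "\<And>t u. 0 \<le> t \<Longrightarrow> t \<le> u \<Longrightarrow> u \<le> 1 \<Longrightarrow> R t - R u \<le> C * (u - t) * (S u - S t)"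
  shows "R 0 \<le> R 1"
proof -
  have bound: "R 0 - R 1 \<le> C * (S 1 - S 0) / real n" if n: "n > 0" for n
  proof -
    have step: "R (real i / real n) - R (real (Suc i) / real n)
        \<le> C / real n * (S (real (Suc i) / real n) - S (real i / real n))" if "i < n" for i
    proof -
      have "real (Suc i) / real n - real i / real n = 1 / real n"
        by (simp add: add_divide_distrib)
      then show ?thesis
        using assms[of "real i / real n" "real (Suc i) / real n"] n that
        by (simp add: divide_right_mono)
    qed
    have "R 0 - R 1 = (\<Sum>i<n. R (real i / real n) - R (real (Suc i) / real n))"
      using n by (subst sum_lessThan_telescope') simp
    also have "\<dots> \<le> (\<Sum>i<n. C / real n * (S (real (Suc i) / real n) - S (real i / real n)))"
      by (intro sum_mono step) simp
    also have "\<dots> = C / real n * (S 1 - S 0)"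
      unfolding sum_distrib_left[symmetric] using n by (subst sum_lessThan_telescope) simp
    finally show ?thesis by simp
  qed
  have "(\<lambda>n. C * (S 1 - S 0) / real n) \<longlonglongrightarrow> 0"
    by (rule lim_const_over_n)
  moreover have "\<forall>\<^sub>F n in sequentially. R 0 - R 1 \<le> C * (S 1 - S 0) / real n"
    using eventually_gt_at_top[of 0] by eventually_elim (rule bound)
  ultimately have "R 0 - R 1 \<le> 0"
    by (rule tendsto_lowerbound) simp
  then show ?thesis by simp
qed

text \<open>Neither \<open>f\<close> nor \<open>g\<close> need be differentiable, so the logarithmic
  derivatives are replaced by subgradients: over [t,u] the ratio \<open>g / f\<close> drops by at
  most a constant times \<open>(u - t) * (S u - S t)\<close>, and such drops add up to nothing under
  refinement.\<close>

lemma gauge_ratio_le: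
  fixes \<gamma> :: "'a::real_vector \<Rightarrow> real"
  assumes gauge: "gauge_fun \<gamma>" and add: "birkhoff_left_additive \<gamma>"
    and avoid: "\<And>t. p + t *\<^sub>R (q - p) \<noteq> 0"
  shows "\<gamma> (- p) / \<gamma> p \<le> \<gamma> (- q) / \<gamma> q"
proof -
  define v where "v = q - p"
  define f where "f = (\<lambda>t. \<gamma> (p + t *\<^sub>R v))"
  define g where "g = (\<lambda>t. \<gamma> (- (p + t *\<^sub>R v)))"
  \<comment> \<open>The right derivative of the convex function \<open>f\<close>, as an infimum of
    secant slopes; it selects one subgradient at every point.\<close>
  define S where "S = (\<lambda>x. Inf ((\<lambda>t. (f x - f t) / (x - t)) ` ({x<..} \<inter> UNIV)))"
  have sub: "f x + S x * (y - x) \<le> f y" for x y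
    unfolding S_def f_def
    by (rule convex_le_Inf_differential[OF gauge_convex_on_line[OF gauge]]) auto
  have f_pos: "f t > 0" for t
    using gauge_pos[OF gauge avoid] by (simp add: f_def v_def)
  have g_nonneg: "g t \<ge> 0" for t
    using gauge_nonneg[OF gauge] by (simp add: g_def)
  have opp: "g t + g t * (S t * (u - t) / f t) \<le> g u" for t u
  proof -
    have "\<gamma> (- (p + t *\<^sub>R v)) * (1 + S t * (u - t) / \<gamma> (p + t *\<^sub>R v))
        \<le> \<gamma> (- ((p + t *\<^sub>R v) + (u - t) *\<^sub>R v))"
    proof (rule subgradient_opposite[OF gauge add])
      show "p + t *\<^sub>R v \<noteq> 0" using avoid by (simp add: v_def)
      fix h
      show "\<gamma> (p + t *\<^sub>R v) + S t * h \<le> \<gamma> (p + t *\<^sub>R v + h *\<^sub>R v)"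
        using sub[of t "t + h"] by (simp add: f_def algebra_simps)
    qed
    then show ?thesis by (simp add: f_def g_def algebra_simps)
  qed
  obtain m where m: "m > 0" "\<And>t. t \<in> {0..1} \<Longrightarrow> m \<le> f t"
  proof -
    have "continuous_on {0..1} f"
      unfolding f_def by (rule gauge_continuous_on_line[OF gauge])
    then obtain t0 where "\<forall>t\<in>{0..1}. f t0 \<le> f t"
      using continuous_attains_inf[of "{0..1::real}" f] by auto
    then show thesis using that[of "f t0"] f_pos by blast
  qed
  obtain K where K: "\<And>t. t \<in> {0..1} \<Longrightarrow> g t \<le> K"
  proof -
    have "continuous_on {0..1} (\<lambda>t. \<gamma> (- p + t *\<^sub>R (- v)))"
      by (rule gauge_continuous_on_line[OF gauge])
    then have "continuous_on {0..1} g" by (simp add: g_def)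
    then obtain t0 where "\<forall>t\<in>{0..1}. g t \<le> g t0"
      using continuous_attains_sup[of "{0..1::real}" g] by auto
    then show thesis using that[of "g t0"] by blast
  qed
  have "g 0 / f 0 \<le> g 1 / f 1"
  proof (rule le_of_product_increment_bound[where S = S and C = "K / (m * m)"])
    fix t u :: real assume tu: "0 \<le> t" "t \<le> u" "u \<le> 1"
    \<comment> \<open>The slope at \<open>u\<close> bounds \<open>f u\<close> from above, while the
      transferred slope at \<open>t\<close> bounds \<open>g u\<close> from below. The mismatch
      \<open>S u - S t\<close> is the error term.\<close>
    have incr_f: "f u - f t \<le> S u * (u - t)"
      using sub[of u t] by (simp add: algebra_simps)
    \<comment> \<open>Adding the subgradient inequalities at \<open>t\<close> and \<open>u\<close>
      gives monotonicity of \<open>S\<close>, in a form that includes \<open>t = u\<close>.\<close>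
    have incr_S: "0 \<le> (u - t) * (S u - S t)"
      using sub[of t u] sub[of u t] by (simp add: algebra_simps)
    have "f t * (g t + g t * (S t * (u - t) / f t)) \<le> f t * g u"
      using opp f_pos[of t] by (intro mult_left_mono) auto
    then have incr_g: "f t * g t + g t * (S t * (u - t)) \<le> f t * g u"
      using f_pos[of t] by (simp add: distrib_left)
    have "g t * f u \<le> g t * (f t + S u * (u - t))"
      using incr_f g_nonneg[of t] by (intro mult_left_mono) auto
    then have "g t * f u - f t * g u \<le> g t * ((u - t) * (S u - S t))"
      using incr_g by (simp add: algebra_simps)
    also have "\<dots> \<le> K * ((u - t) * (S u - S t))"
      using K[of t] tu incr_S by (intro mult_right_mono) auto
    finally have num: "g t * f u - f t * g u \<le> K * ((u - t) * (S u - S t))" .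
    have K0: "K \<ge> 0" using K[of 0] g_nonneg[of 0] by simp
    have "g t / f t - g u / f u = (g t * f u - f t * g u) / (f t * f u)"
      using f_pos[of t] f_pos[of u] by (simp add: field_simps)
    also have "\<dots> \<le> K * ((u - t) * (S u - S t)) / (f t * f u)"
      using num f_pos[of t] f_pos[of u] by (intro divide_right_mono) auto
    also have "\<dots> \<le> K * ((u - t) * (S u - S t)) / (m * m)"
    proof (rule divide_left_mono)
      show "m * m \<le> f t * f u"
        using m tu f_pos[of t] by (intro mult_mono) (auto simp: less_imp_le)
      show "0 \<le> K * ((u - t) * (S u - S t))"
        using K0 incr_S by (rule mult_nonneg_nonneg)
      show "0 < f t * f u * (m * m)"
        using m(1) f_pos by simp
    qed
    finally show "g t / f t - g u / f u \<le> K / (m * m) * (u - t) * (S u - S t)"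
      by simp
  qed
  then show ?thesis by (simp add: f_def g_def v_def)
qed

section \<open>Symmetry of the gauge\<close>

lemma gauge_symmetric_of_left_additive:
  fixes \<gamma> :: "'a::real_vector \<Rightarrow> real"
  assumes gauge: "gauge_fun \<gamma>" and add: "birkhoff_left_additive \<gamma>"
    and p: "p \<noteq> 0" and q: "q \<notin> span {p}"
  shows "\<gamma> (- p) = \<gamma> p"
proof -
  have indep: "a = 0 \<and> b = 0" if "a *\<^sub>R p + b *\<^sub>R q = 0" for a b
  proof -
    have "b = 0"
    proof (rule ccontr)
      assume b: "b \<noteq> 0"
      have "b *\<^sub>R q = (- a) *\<^sub>R p"
        using that by (simp add: add_eq_0_iff)
      then have "(1 / b) *\<^sub>R (b *\<^sub>R q) = (1 / b) *\<^sub>R ((- a) *\<^sub>R p)" by simp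
      then have "q = (- a / b) *\<^sub>R p" using b by simp
      then have "q \<in> span {p}" by (metis span_base span_scale singletonI)
      then show False using q by blast
    qed
    then show ?thesis using that p by simp
  qed
  \<comment> \<open>The lines from \<open>a *\<^sub>R p\<close> to \<open>q\<close> and from
    \<open>q\<close> to \<open>- (a *\<^sub>R p)\<close> both miss the origin by independence.
    Taking \<open>a = 1\<close> and \<open>a = - 1\<close> yields the two opposite inequalities
    between the ratio at \<open>p\<close> and its inverse.\<close>
  have le: "\<gamma> (- (a *\<^sub>R p)) / \<gamma> (a *\<^sub>R p) \<le> \<gamma> (a *\<^sub>R p) / \<gamma> (- (a *\<^sub>R p))" if a: "a \<noteq> 0" for a
  proof -
    have "\<gamma> (- (a *\<^sub>R p)) / \<gamma> (a *\<^sub>R p) \<le> \<gamma> (- q) / \<gamma> q"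
    proof (rule gauge_ratio_le[OF gauge add])
      fix t
      have "a *\<^sub>R p + t *\<^sub>R (q - a *\<^sub>R p) = (a * (1 - t)) *\<^sub>R p + t *\<^sub>R q"
        by (simp add: algebra_simps)
      then show "a *\<^sub>R p + t *\<^sub>R (q - a *\<^sub>R p) \<noteq> 0"
        using indep[of "a * (1 - t)" t] a by auto
    qed
    also have "\<dots> \<le> \<gamma> (- (- (a *\<^sub>R p))) / \<gamma> (- (a *\<^sub>R p))"
    proof (rule gauge_ratio_le[OF gauge add])
      fix t
      have "q + t *\<^sub>R (- (a *\<^sub>R p) - q) = (- (a * t)) *\<^sub>R p + (1 - t) *\<^sub>R q"
        by (simp add: algebra_simps)
      then show "q + t *\<^sub>R (- (a *\<^sub>R p) - q) \<noteq> 0"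
        using indep[of "- (a * t)" "1 - t"] a by auto
    qed
    finally show ?thesis by simp
  qed
  have pos: "\<gamma> p > 0" "\<gamma> (- p) > 0"
    using gauge_pos[OF gauge] p by auto
  have "\<gamma> (- p) / \<gamma> p = \<gamma> p / \<gamma> (- p)"
    using le[of 1] le[of "- 1"] by simp
  then have "(\<gamma> (- p))\<^sup>2 = (\<gamma> p)\<^sup>2"
    using pos by (simp add: field_simps power2_eq_square)
  then show ?thesis using pos by (simp add: power2_eq_iff_nonneg)
qed

theorem theorem3p20:
  fixes \<gamma> :: "real ^ 'n \<Rightarrow> real"
  assumes "CARD('n) \<ge> 2"
    and "gauge_fun \<gamma>"
    and "birkhoff_left_additive \<gamma>"
  shows "norm_fun \<gamma>"
proof -
  note gauge = assms(2)
  have sym: "\<gamma> (- p) = \<gamma> p" for p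
  proof (cases "p = 0")
    case False
    \<comment> \<open>The dimension hypothesis supplies \<open>q\<close>. In dimension one only 0 is
      orthogonal to a nonzero vector, so even asymmetric gauges are left additive there.\<close>
    have "dim (span {p}) \<le> card {p}" by (simp only: dim_span) (rule dim_le_card', simp)
    then have "span {p} \<noteq> UNIV" using assms(1) by (metis card.empty card.insert dim_UNIV DIM_cart DIM_real dim_span empty_iff finite.emptyI mult_1_right not_less_eq_eq numeral_2_eq_2 order_trans)
    then obtain q where "q \<notin> span {p}" by auto
    then show ?thesis
      using gauge_symmetric_of_left_additive[OF gauge assms(3) False] by blast
  qed simp
  have scale: "\<gamma> (c *\<^sub>R x) = \<bar>c\<bar> * \<gamma> x" for c x
  proof (cases "c \<ge> 0")
    case False
    then show ?thesis
      using gauge_scale[OF gauge, of "- c" x] sym[of "c *\<^sub>R x"] by simp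
  qed (simp add: gauge_scale[OF gauge])
  show ?thesis
    unfolding norm_fun_def
    using gauge_nonneg[OF gauge] gauge_eq_0D[OF gauge] gauge_zero[OF gauge] scale
      gauge_triangle[OF gauge] by blast
qed

end
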